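(* There exists a finitely generated group $G$ such that $\mathrm{PW}(G,X)$ is finite for every finite generating set $X$ of $G$, but $G$ is not boundedly generated.
   Context: A group $G$ is boundedly generated when there exist $k$ and $a_1,\ldots,a_k\in G$ such that every element of $G$ can be expressed as $a_1^{r_1}\cdots a_k^{r_k}$ for some $r_1,\ldots,r_k\in\mathbb{Z}$. For a group $G$ with generating set $X$, a palindromic word on $X \cup X^{-1}$ is a finite word with letters in $X\cup X^{-1}$ (not necessarily reduced) that reads the same forwards as backwards. The palindromic width $\mathrm{PW}(G,X)$ is the minimal $n$ such that every $g\in G$ can be expressed as a product of $n$ or fewer elements represented by palindromic words on $X\cup X^{-1}$ (and is infinite if no such $n$ exists). *)

theory Defs
  imports "HOL-Algebra.Generated_Groups" "HOL-Library.Extended_Nat"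
begin

definition list_prod :: "('a, 'b) monoid_scheme \<Rightarrow> 'a list \<Rightarrow> 'a"
  where "list_prod G xs = foldr (\<otimes>\<^bsub>G\<^esub>) xs \<one>\<^bsub>G\<^esub>"

definition generating_set :: "('a, 'b) monoid_scheme \<Rightarrow> 'a set \<Rightarrow> bool"
  where "generating_set G X \<longleftrightarrow> X \<subseteq> carrier G \<and> generate G X = carrier G"

definition finitely_generated :: "('a, 'b) monoid_scheme \<Rightarrow> bool"
  where "finitely_generated G \<longleftrightarrow> (\<exists>X. finite X \<and> generating_set G X)"

definition boundedly_generated :: "('a, 'b) monoid_scheme \<Rightarrow> bool"
  where "boundedly_generated G \<longleftrightarrow>
    (\<exists>as. set as \<subseteq> carrier G \<and>
      (\<forall>g \<in> carrier G. \<exists>rs :: int list. length rs = length as \<and>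
        g = list_prod G (map2 (\<lambda>a r. a [^]\<^bsub>G\<^esub> r) as rs)))"

(* The letters are elements of G, i.e. the union of X and its inverses is formed inside G.
   Words need not be reduced, and the empty word is a palindrome. *)
definition palindromic_word :: "('a, 'b) monoid_scheme \<Rightarrow> 'a set \<Rightarrow> 'a list \<Rightarrow> bool"
  where "palindromic_word G X w \<longleftrightarrow>
    set w \<subseteq> X \<union> (\<lambda>x. inv\<^bsub>G\<^esub> x) ` X \<and> rev w = w"

definition palindromic_elements :: "('a, 'b) monoid_scheme \<Rightarrow> 'a set \<Rightarrow> 'a set"
  where "palindromic_elements G X = {list_prod G w | w. palindromic_word G X w}"

(* The infimum of the empty set in enat is infinity. *)
definition palindromic_width :: "('a, 'b) monoid_scheme \<Rightarrow> 'a set \<Rightarrow> enat"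
  where "palindromic_width G X =
    Inf {enat n | n. \<forall>g \<in> carrier G. \<exists>ps. length ps \<le> n \<and>
      set ps \<subseteq> palindromic_elements G X \<and> g = list_prod G ps}"

end

theory Submission
  imports Defs "HOL-Algebra.Zassenhaus" "HOL-Algebra.Weak_Morphisms" "HOL-Library.Countable_Set"
begin

text \<open>
  The group is the lamplighter group. Let \<open>A\<close> be its abelian normal subgroup of lamp configurations and
  let \<open>X\<close> be a finite generating set. For \<open>u\<close> in \<open>A\<close> and \<open>x\<close> in \<open>X\<close> the commutator \<open>[u, x]\<close> is a
  product of three palindromes. For fixed \<open>x\<close> these commutators form a subgroup, and the product of
  these subgroups over all \<open>x\<close> in \<open>X\<close> is \<open>[A, G]\<close>. As \<open>G / [A, G]\<close> is abelian, every element is a product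
  of powers of the generators and an element of \<open>[A, G]\<close>.

  If a group is a product of \<open>k\<close> cyclic subgroups, then its quotients of exponent \<open>e\<close> have order at
  most \<open>e\<^sup>k\<close>. The lamplighter group has, for each \<open>n\<close>, a quotient of exponent dividing \<open>2 n\<close> and
  order at least \<open>2\<^sup>n\<close>.
\<close>

section \<open>Finite palindromic width as bounded products of palindromes\<close>

text \<open>The bound is attached to an arbitrary set \<open>S\<close> because the whole group is
  later assembled as a product of subgroups, each with a bound of its own.\<close>

definition bounded_palindromic :: "('a, 'b) monoid_scheme \<Rightarrow> 'a set \<Rightarrow> 'a set \<Rightarrow> bool"
  where "bounded_palindromic G X S \<longleftrightarrow>
    (\<exists>n. \<forall>g \<in> S. \<exists>ps. length ps \<le> n \<and>
      set ps \<subseteq> palindromic_elements G X \<and> g = list_prod G ps)"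

lemma palindromic_width_finite_iff:
  "palindromic_width G X < \<infinity> \<longleftrightarrow> bounded_palindromic G X (carrier G)"
proof
  assume "palindromic_width G X < \<infinity>"
  then show "bounded_palindromic G X (carrier G)"
    unfolding palindromic_width_def Inf_less_iff bounded_palindromic_def by blast
next
  assume "bounded_palindromic G X (carrier G)"
  then obtain n where "\<forall>g \<in> carrier G. \<exists>ps. length ps \<le> n \<and>
      set ps \<subseteq> palindromic_elements G X \<and> g = list_prod G ps"
    unfolding bounded_palindromic_def by blast
  then have "palindromic_width G X \<le> enat n"
    unfolding palindromic_width_def by (intro Inf_lower) blast
  then show "palindromic_width G X < \<infinity>"
    using enat_ord_simps(4) order_le_less_trans by blast
qed

lemma palindromic_elementsI: "palindromic_word G X w \<Longrightarrow> list_prod G w \<in> palindromic_elements G X"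
  by (auto simp: palindromic_elements_def)

section \<open>Words, palindromes and the elements they spell\<close>

lemma list_prod_Nil [simp]: "list_prod G [] = \<one>\<^bsub>G\<^esub>"
  by (simp add: list_prod_def)

lemma list_prod_Cons [simp]: "list_prod G (x # xs) = x \<otimes>\<^bsub>G\<^esub> list_prod G xs"
  by (simp add: list_prod_def)

context group
begin

lemma list_prod_closed [simp]: "set xs \<subseteq> carrier G \<Longrightarrow> list_prod G xs \<in> carrier G"
  by (induction xs) auto

lemma list_prod_append:
  "set xs \<subseteq> carrier G \<Longrightarrow> set ys \<subseteq> carrier G \<Longrightarrow>
    list_prod G (xs @ ys) = list_prod G xs \<otimes> list_prod G ys"
  by (induction xs) (auto simp: m_assoc)

lemma inv_list_prod:
  "set xs \<subseteq> carrier G \<Longrightarrow> inv (list_prod G xs) = list_prod G (map (\<lambda>x. inv x) (rev xs))"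
proof (induction xs)
  case (Cons x xs)
  then have "set (map (\<lambda>x. inv x) (rev xs)) \<subseteq> carrier G"
    by auto
  with Cons show ?case
    by (simp add: inv_mult_group list_prod_append)
qed simp

lemma list_prod_replicate:
  "x \<in> carrier G \<Longrightarrow> list_prod G (replicate n x) = x [^] n"
  by (induction n) (simp, metis list_prod_Cons nat_pow_Suc2 replicate_Suc)

lemma m_inv_cancel [simp]:
  assumes "x \<in> carrier G" "y \<in> carrier G"
  shows "x \<otimes> (inv x \<otimes> y) = y" "inv x \<otimes> (x \<otimes> y) = y"
  using assms by (simp_all flip: m_assoc)

lemma letters_closed: "X \<subseteq> carrier G \<Longrightarrow> X \<union> (\<lambda>x. inv x) ` X \<subseteq> carrier G"
  by auto

lemma palindromic_elements_closed:
  assumes "X \<subseteq> carrier G" shows "palindromic_elements G X \<subseteq> carrier G"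
  using letters_closed[OF assms]
  by (force simp: palindromic_elements_def palindromic_word_def intro!: list_prod_closed)

text \<open>Inverting a product reverses the word and inverts each letter; a palindrome absorbs the
  reversal.\<close>

lemma palindromic_elements_inv:
  assumes X: "X \<subseteq> carrier G" and p: "p \<in> palindromic_elements G X"
  shows "inv p \<in> palindromic_elements G X"
proof -
  obtain w where w: "p = list_prod G w" "set w \<subseteq> X \<union> (\<lambda>x. inv x) ` X" "rev w = w"
    using p by (auto simp: palindromic_elements_def palindromic_word_def)
  have "inv p = list_prod G (map (\<lambda>x. inv x) w)"
    using inv_list_prod[of w] w letters_closed[OF X] by auto
  moreover have "palindromic_word G X (map (\<lambda>x. inv x) w)"
    using w X by (force simp: palindromic_word_def rev_map)
  ultimately show ?thesis
    by (auto intro: palindromic_elementsI)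
qed

text \<open>A word that repeats one letter is a palindrome, so each element of a cyclic subgroup
  generated by a letter costs one palindrome.\<close>

lemma palindromic_elements_int_pow:
  assumes X: "X \<subseteq> carrier G" and x: "x \<in> X"
  shows "x [^] (r::int) \<in> palindromic_elements G X"
proof -
  have nat: "x [^] n \<in> palindromic_elements G X" for n :: nat
    using palindromic_elementsI[of G X "replicate n x"] x X
    by (auto simp: palindromic_word_def list_prod_replicate subset_iff)
  show ?thesis
    using nat[of "nat r"] palindromic_elements_inv[OF X nat[of "nat (- r)"]]
    unfolding int_pow_def2 by presburger
qed

text \<open>Reversal makes sense for words only, so an element has to be spelled out before a
  palindrome can be built around it.\<close>

lemma generate_eq_words:
  assumes X: "X \<subseteq> carrier G" and "g \<in> generate G X"
  obtains w where "set w \<subseteq> X \<union> (\<lambda>x. inv x) ` X" "g = list_prod G w"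
proof -
  have "\<exists>w. set w \<subseteq> X \<union> (\<lambda>x. inv x) ` X \<and> g = list_prod G w"
    using assms(2)
  proof induction
    case one
    show ?case by (intro exI[of _ "[]"]) simp
  next
    case (incl h)
    then show ?case using X by (intro exI[of _ "[h]"]) auto
  next
    case (inv h)
    then show ?case using X by (intro exI[of _ "[inv h]"]) auto
  next
    case (eng g h)
    then obtain v w where "set v \<subseteq> X \<union> (\<lambda>x. inv x) ` X" "g = list_prod G v"
      "set w \<subseteq> X \<union> (\<lambda>x. inv x) ` X" "h = list_prod G w"
      by blast
    moreover from this have "set v \<subseteq> carrier G" "set w \<subseteq> carrier G"
      using letters_closed[OF X] by blast+
    ultimately show ?case
      by (intro exI[of _ "v @ w"]) (simp add: list_prod_append)
  qed
  with that show thesis by blast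
qed

section \<open>Commutators and sets of bounded palindromic length\<close>

abbreviation commutator :: "'a \<Rightarrow> 'a \<Rightarrow> 'a"
  where "commutator x y \<equiv> x \<otimes> y \<otimes> inv x \<otimes> inv y"

text \<open>Writing \<open>v\<close> for the element spelled by the reversed word of \<open>u\<close>, the commutator is
  \<open>(u x v) (u v)\<^sup>-\<^sup>1 x\<^sup>-\<^sup>1\<close>, a product of three palindromes.\<close>

lemma commutator_palindromes:
  assumes X: "X \<subseteq> carrier G" and u: "u \<in> generate G X" and x: "x \<in> X"
  obtains p q r where "{p, q, r} \<subseteq> palindromic_elements G X" "commutator u x = p \<otimes> q \<otimes> r"
proof -
  obtain w where w: "set w \<subseteq> X \<union> (\<lambda>x. inv x) ` X" "u = list_prod G w"
    using generate_eq_words[OF X u] .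
  \<comment> \<open>\<open>v\<close> depends on the chosen word \<open>w\<close> and not on
    \<open>u\<close> alone; this is harmless because \<open>v\<close> cancels from the
    commutator.\<close>
  define v where "v = list_prod G (rev w)"
  have wc: "set w \<subseteq> carrier G" and xc: "x \<in> carrier G"
    using w letters_closed[OF X] X x by auto
  have uv: "u \<in> carrier G" "v \<in> carrier G"
    using wc by (auto simp: w v_def)
  have "list_prod G (w @ x # rev w) = u \<otimes> x \<otimes> v"
    using wc xc by (simp add: list_prod_append w v_def m_assoc)
  moreover have "palindromic_word G X (w @ x # rev w)"
    using w x by (auto simp: palindromic_word_def)
  ultimately have 1: "u \<otimes> x \<otimes> v \<in> palindromic_elements G X"
    by (metis palindromic_elementsI)
  have "list_prod G (w @ rev w) = u \<otimes> v"
    using wc by (simp add: list_prod_append w v_def)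
  moreover have "palindromic_word G X (w @ rev w)"
    using w by (auto simp: palindromic_word_def)
  ultimately have 2: "inv (u \<otimes> v) \<in> palindromic_elements G X"
    by (metis palindromic_elementsI palindromic_elements_inv X)
  have 3: "inv x \<in> palindromic_elements G X"
    using palindromic_elements_int_pow[OF X x, of "-1"] xc by (simp add: int_pow_neg)
  have "commutator u x = (u \<otimes> x \<otimes> v) \<otimes> inv (u \<otimes> v) \<otimes> inv x"
    using uv xc by (simp add: m_assoc inv_mult_group)
  with 1 2 3 that show thesis by (metis empty_subsetI insert_subset)
qed

lemma subset_set_mult:
  assumes "subgroup H G" "subgroup K G"
  shows "H \<subseteq> H <#> K" "K \<subseteq> H <#> K"
proof -
  have "h = h \<otimes> \<one>" "\<one> \<in> K" if "h \<in> H" for h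
    using that assms by (auto dest: subgroup.mem_carrier subgroup.one_closed)
  then show "H \<subseteq> H <#> K"
    unfolding set_mult_def by blast
  have "k = \<one> \<otimes> k" "\<one> \<in> H" if "k \<in> K" for k
    using that assms by (auto dest: subgroup.mem_carrier subgroup.one_closed)
  then show "K \<subseteq> H <#> K"
    unfolding set_mult_def by blast
qed

lemma bounded_palindromic_mono:
  "bounded_palindromic G X T \<Longrightarrow> S \<subseteq> T \<Longrightarrow> bounded_palindromic G X S"
  unfolding bounded_palindromic_def by (meson subsetD)

lemma bounded_palindromic_set_mult:
  assumes X: "X \<subseteq> carrier G"
    and S: "bounded_palindromic G X S" and T: "bounded_palindromic G X T"
  shows "bounded_palindromic G X (S <#> T)"
proof -
  obtain m where m: "\<And>g. g \<in> S \<Longrightarrow> \<exists>ps. length ps \<le> m \<and>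
      set ps \<subseteq> palindromic_elements G X \<and> g = list_prod G ps"
    using S unfolding bounded_palindromic_def by blast
  obtain n where n: "\<And>g. g \<in> T \<Longrightarrow> \<exists>ps. length ps \<le> n \<and>
      set ps \<subseteq> palindromic_elements G X \<and> g = list_prod G ps"
    using T unfolding bounded_palindromic_def by blast
  have "\<exists>ps. length ps \<le> m + n \<and>
      set ps \<subseteq> palindromic_elements G X \<and> g = list_prod G ps" if "g \<in> S <#> T" for g
  proof -
    obtain s t where st: "s \<in> S" "t \<in> T" "g = s \<otimes> t"
      using \<open>g \<in> S <#> T\<close> unfolding set_mult_def by blast
    obtain ps qs where "length ps \<le> m" "set ps \<subseteq> palindromic_elements G X" "s = list_prod G ps"
      "length qs \<le> n" "set qs \<subseteq> palindromic_elements G X" "t = list_prod G qs"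
      using m[OF st(1)] n[OF st(2)] by blast
    then show ?thesis
      using st(3) palindromic_elements_closed[OF X]
      by (intro exI[of _ "ps @ qs"]) (auto simp: list_prod_append)
  qed
  then show ?thesis
    unfolding bounded_palindromic_def by blast
qed

lemma bounded_palindromic_one: "bounded_palindromic G X {\<one>}"
  unfolding bounded_palindromic_def by (auto intro!: exI[of _ "0::nat"])

lemma bounded_palindromic_generate_single:
  assumes X: "X \<subseteq> carrier G" and x: "x \<in> X"
  shows "bounded_palindromic G X (generate G {x})"
proof -
  have "\<exists>ps. length ps \<le> 1 \<and> set ps \<subseteq> palindromic_elements G X \<and> g = list_prod G ps"
    if "g \<in> generate G {x}" for g
  proof -
    have "g \<in> palindromic_elements G X"
      using that X x palindromic_elements_int_pow by (auto simp: generate_pow subset_iff)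
    then show ?thesis
      using palindromic_elements_closed[OF X] by (intro exI[of _ "[g]"]) auto
  qed
  then show ?thesis
    unfolding bounded_palindromic_def by blast
qed

lemma bounded_palindromic_commutators:
  assumes X: "X \<subseteq> carrier G" and A: "A \<subseteq> generate G X" and x: "x \<in> X"
  shows "bounded_palindromic G X ((\<lambda>u. commutator u x) ` A)"
proof -
  have "\<exists>ps. length ps \<le> 3 \<and> set ps \<subseteq> palindromic_elements G X \<and> g = list_prod G ps"
    if "g \<in> (\<lambda>u. commutator u x) ` A" for g
  proof -
    obtain u where u: "u \<in> generate G X" "g = commutator u x"
      using \<open>g \<in> _\<close> A by blast
    obtain p q r where pqr: "{p, q, r} \<subseteq> palindromic_elements G X" "g = p \<otimes> q \<otimes> r"
      using commutator_palindromes[OF X u(1) x] u(2) by metis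
    then have "{p, q, r} \<subseteq> carrier G"
      using palindromic_elements_closed[OF X] by blast
    then show ?thesis
      using pqr by (intro exI[of _ "[p, q, r]"]) (auto simp: m_assoc)
  qed
  then show ?thesis
    unfolding bounded_palindromic_def by blast
qed

section \<open>Commutators with an abelian normal subgroup\<close>

text \<open>Since \<open>A\<close> is abelian and normal, sending \<open>u\<close> to
  \<open>[u, x] = u (x u^-1 x^-1)\<close> is a homomorphism on \<open>A\<close>. A product of
  commutators with the same \<open>x\<close> is thus a single such commutator, so three palindromes
  suffice for the whole subgroup.\<close>

lemma subgroup_commutators:
  assumes A: "A \<lhd> G" and comm: "\<And>a b. a \<in> A \<Longrightarrow> b \<in> A \<Longrightarrow> a \<otimes> b = b \<otimes> a"
    and x: "x \<in> carrier G"
  shows "subgroup ((\<lambda>u. commutator u x) ` A) G" "(\<lambda>u. commutator u x) ` A \<subseteq> A"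
proof -
  interpret A: normal A G by fact
  have conj: "x \<otimes> a \<otimes> inv x \<in> A" if "a \<in> A" for a
    using that x by (rule A.inv_op_closed2[rotated])
  have eq: "commutator u x = u \<otimes> (x \<otimes> inv u \<otimes> inv x)" if "u \<in> A" for u
    using that x by (simp add: m_assoc)
  show sub: "(\<lambda>u. commutator u x) ` A \<subseteq> A"
    using conj by (auto simp: eq)
  have mult: "commutator (a \<otimes> b) x = commutator a x \<otimes> commutator b x"
    if a: "a \<in> A" and b: "b \<in> A" for a b
  proof -
    have "commutator (a \<otimes> b) x = a \<otimes> (commutator b x \<otimes> (x \<otimes> inv a \<otimes> inv x))"
      using a b x by (simp add: m_assoc inv_mult_group)
    also have "commutator b x \<otimes> (x \<otimes> inv a \<otimes> inv x) = (x \<otimes> inv a \<otimes> inv x) \<otimes> commutator b x"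
      using a b sub conj by (intro comm) auto
    finally show ?thesis
      using a b x by (simp add: m_assoc)
  qed
  have "group_hom (G\<lparr>carrier := A\<rparr>) G (\<lambda>u. commutator u x)"
    using A.subgroup_axioms x
    by (intro group_hom.intro group_hom_axioms.intro)
      (auto simp: hom_def mult subgroup_imp_group is_group)
  then interpret h: group_hom "G\<lparr>carrier := A\<rparr>" G "\<lambda>u. commutator u x" .
  show "subgroup ((\<lambda>u. commutator u x) ` A) G"
    using h.img_is_subgroup by simp
qed

text \<open>Induction on \<open>g\<close> with \<open>[a, g h] = [a, h] [h a h^-1, g]\<close>. The
  conjugate of \<open>a\<close> stays in \<open>A\<close> but differs from \<open>a\<close>, so
  \<open>a\<close> must vary in the induction.\<close>

lemma commutators_generate:
  assumes A: "A \<lhd> G" and comm: "\<And>a b. a \<in> A \<Longrightarrow> b \<in> A \<Longrightarrow> a \<otimes> b = b \<otimes> a"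
    and X: "X \<subseteq> carrier G" and B: "subgroup B G"
    and AX: "\<And>a x. a \<in> A \<Longrightarrow> x \<in> X \<Longrightarrow> commutator a x \<in> B"
    and g: "g \<in> generate G X" and a: "a \<in> A"
  shows "commutator a g \<in> B"
proof -
  interpret A: normal A G by fact
  interpret B: subgroup B G by fact
  show ?thesis
    using g a
  proof (induction arbitrary: a)
    case one
    then show ?case using A.subset by auto
  next
    case (incl h)
    then show ?case using AX by simp
  next
    case (inv h)
    then have h: "h \<in> carrier G" using X by auto
    \<comment> \<open>With this \<open>b\<close> in \<open>A\<close>, \<open>[a, h^-1] = a b\<close>
      and \<open>[b, h] = b a\<close>, so an inverse generator reduces to the generator.\<close>
    let ?b = "inv h \<otimes> inv a \<otimes> h"
    have b: "?b \<in> A"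
      using inv h by (intro A.inv_op_closed1) auto
    have "commutator a (inv h) = a \<otimes> ?b"
      using inv h by (simp add: m_assoc)
    also have "\<dots> = ?b \<otimes> a"
      using b inv by (intro comm) auto
    also have "\<dots> = commutator ?b h"
      using inv h by (simp add: m_assoc inv_mult_group)
    finally show ?case
      using AX b inv by simp
  next
    case (eng g h)
    then have gh: "g \<in> carrier G" "h \<in> carrier G" "a \<in> carrier G"
      using generate_in_carrier[OF X] by auto
    have "h \<otimes> a \<otimes> inv h \<in> A"
      using eng gh by (intro A.inv_op_closed2) auto
    then have "commutator a h \<otimes> commutator (h \<otimes> a \<otimes> inv h) g \<in> B"
      using B.m_closed[OF eng.IH(2)[OF eng.prems] eng.IH(1)] by blast
    moreover have "commutator a h \<otimes> commutator (h \<otimes> a \<otimes> inv h) g = commutator a (g \<otimes> h)"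
      using gh by (simp add: m_assoc inv_mult_group)
    ultimately show ?case by (simp only:)
  qed
qed

text \<open>\<open>B\<close> is the product of the subgroups \<open>[A, x]\<close> over
  \<open>x\<close> in \<open>X\<close>; as \<open>X\<close> is finite, the bounds add up to a finite
  one.\<close>

lemma bounded_palindromic_commutator_subgroup:
  assumes A: "A \<lhd> G" and comm: "\<And>a b. a \<in> A \<Longrightarrow> b \<in> A \<Longrightarrow> a \<otimes> b = b \<otimes> a"
    and X: "finite X" "generating_set G X"
  obtains B where "subgroup B G" "bounded_palindromic G X B"
    "\<And>a g. a \<in> A \<Longrightarrow> g \<in> carrier G \<Longrightarrow> commutator a g \<in> B"
proof -
  interpret A: normal A G by fact
  have XG: "X \<subseteq> carrier G" "generate G X = carrier G"
    using X by (auto simp: generating_set_def)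
  have A_group: "group (G\<lparr>carrier := A\<rparr>)"
    using A.subgroup_axioms by (rule subgroup_imp_group)
  interpret A': comm_group "G\<lparr>carrier := A\<rparr>"
    using A_group comm by (auto intro!: group.group_comm_groupI)
  \<comment> \<open>\<open>B \<subseteq> A\<close> is carried along because a product of two
    subgroups is a subgroup inside the commutative group on \<open>A\<close>.\<close>
  have "\<exists>B. subgroup B G \<and> B \<subseteq> A \<and> bounded_palindromic G X B \<and>
      (\<forall>a\<in>A. \<forall>x\<in>Y. commutator a x \<in> B)" if "finite Y" "Y \<subseteq> X" for Y
    using that
  proof induction
    case empty
    show ?case
      using triv_subgroup bounded_palindromic_one by (intro exI[of _ "{\<one>}"]) auto
  next
    case (insert x Y)
    then obtain B where B: "subgroup B G" "B \<subseteq> A" "bounded_palindromic G X B"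
      "\<forall>a\<in>A. \<forall>x\<in>Y. commutator a x \<in> B"
      by auto
    let ?C = "(\<lambda>u. commutator u x) ` A"
    have x: "x \<in> X" "x \<in> carrier G"
      using insert XG by auto
    have C: "subgroup ?C G" "?C \<subseteq> A"
      using subgroup_commutators[OF A comm x(2)] by auto
    have "subgroup (?C <#> B) (G\<lparr>carrier := A\<rparr>)"
      using A'.mult_subgroups subgroup_incl[OF _ A.subgroup_axioms] B C by simp
    then have sub: "subgroup (?C <#> B) G" "?C <#> B \<subseteq> A"
      using incl_subgroup[OF A.subgroup_axioms] subgroup.subset by (blast, force)
    have "?C \<subseteq> ?C <#> B" "B \<subseteq> ?C <#> B"
      using subset_set_mult[OF C(1) B(1)] by auto
    then have "\<forall>a\<in>A. \<forall>y\<in>insert x Y. commutator a y \<in> ?C <#> B"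
      using B(4) by blast
    moreover have "bounded_palindromic G X (?C <#> B)"
      using bounded_palindromic_commutators[OF XG(1) _ x(1), of A] B(3) XG A.subset
      by (intro bounded_palindromic_set_mult) auto
    ultimately show ?case
      using sub by blast
  qed
  from this[OF X(1) order_refl] obtain B where B: "subgroup B G" "bounded_palindromic G X B"
      "\<forall>a\<in>A. \<forall>x\<in>X. commutator a x \<in> B"
    by auto
  show thesis
  proof
    show "commutator a g \<in> B" if "a \<in> A" "g \<in> carrier G" for a g
      using commutators_generate[OF A comm XG(1) B(1)] B(3) that XG(2) by blast
  qed (use B in auto)
qed

text \<open>By \<open>derived\<close>, \<open>B\<close> contains every commutator of the group, so
  each subgroup above \<open>B\<close> is normal. Hence \<open>B\<close> can be multiplied by one
  cyclic subgroup per generator until the whole group is reached.\<close>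

theorem palindromic_width_finite:
  assumes A: "A \<lhd> G" and comm: "\<And>a b. a \<in> A \<Longrightarrow> b \<in> A \<Longrightarrow> a \<otimes> b = b \<otimes> a"
    and derived: "\<And>x y. x \<in> carrier G \<Longrightarrow> y \<in> carrier G \<Longrightarrow>
      \<exists>a\<in>A. \<exists>g\<in>carrier G. commutator x y = commutator a g"
    and X: "finite X" "generating_set G X"
  shows "palindromic_width G X < \<infinity>"
proof -
  have XG: "X \<subseteq> carrier G" "generate G X = carrier G"
    using X by (auto simp: generating_set_def)
  obtain B where B: "subgroup B G" "bounded_palindromic G X B"
    and AB: "\<And>a g. a \<in> A \<Longrightarrow> g \<in> carrier G \<Longrightarrow> commutator a g \<in> B"
    using bounded_palindromic_commutator_subgroup[OF A comm X] by blast
  have CB: "commutator x y \<in> B" if "x \<in> carrier G" "y \<in> carrier G" for x y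
    using derived[OF that] AB by force
  have "\<exists>P. subgroup P G \<and> B \<subseteq> P \<and> Y \<subseteq> P \<and> bounded_palindromic G X P"
    if "finite Y" "Y \<subseteq> X" for Y
    using that
  proof induction
    case empty
    show ?case using B by blast
  next
    case (insert x Y)
    then obtain P where P: "subgroup P G" "B \<subseteq> P" "Y \<subseteq> P" "bounded_palindromic G X P"
      by auto
    interpret P: subgroup P G by (rule P(1))
    have x: "x \<in> X" "x \<in> carrier G"
      using insert XG by auto
    have "P \<lhd> G"
      unfolding normal_inv_iff
    proof (intro conjI ballI)
      fix g h assume g: "g \<in> carrier G" and h: "h \<in> P"
      \<comment> \<open>Normality follows from \<open>g h g^-1 = [g, h] h\<close>.\<close>
      have "commutator g h \<otimes> h \<in> P"
        using P.m_closed[OF subsetD[OF P(2) CB[OF g P.mem_carrier[OF h]]] h] .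
      then show "g \<otimes> h \<otimes> inv g \<in> P"
        using g h by (simp add: m_assoc)
    qed (rule P(1))
    moreover have gen: "subgroup (generate G {x}) G"
      using x by (intro generate_is_subgroup) auto
    ultimately have "subgroup (P <#> generate G {x}) G"
      by (rule mult_norm_subgroup)
    moreover have "P \<subseteq> P <#> generate G {x}" "generate G {x} \<subseteq> P <#> generate G {x}"
      using subset_set_mult[OF P(1) gen] by auto
    moreover have "x \<in> generate G {x}"
      by (intro generate.incl) simp
    moreover have "bounded_palindromic G X (P <#> generate G {x})"
      using P XG x by (intro bounded_palindromic_set_mult bounded_palindromic_generate_single)
    ultimately show ?case
      using P by (intro exI[of _ "P <#> generate G {x}"]) blast
  qed
  from this[OF X(1) order_refl] obtain P
    where P: "subgroup P G" "X \<subseteq> P" "bounded_palindromic G X P"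
    by auto
  have "carrier G \<subseteq> P"
    using generate_subgroup_incl[OF P(2,1)] XG by simp
  then show ?thesis
    unfolding palindromic_width_finite_iff by (rule bounded_palindromic_mono[OF P(3)])
qed

end

section \<open>Transfer along homomorphisms\<close>

lemma (in group_hom) hom_list_prod:
  "set xs \<subseteq> carrier G \<Longrightarrow> h (list_prod G xs) = list_prod H (map h xs)"
  by (induction xs) auto

lemma (in group_hom) palindromic_elements_image:
  assumes X: "X \<subseteq> carrier G"
  shows "h ` palindromic_elements G X \<subseteq> palindromic_elements H (h ` X)"
proof
  fix y assume "y \<in> h ` palindromic_elements G X"
  then obtain w where w: "set w \<subseteq> X \<union> (\<lambda>x. inv\<^bsub>G\<^esub> x) ` X" "rev w = w" "y = h (list_prod G w)"
    by (auto simp: palindromic_elements_def palindromic_word_def)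
  have "set (map h w) \<subseteq> h ` (X \<union> (\<lambda>x. inv\<^bsub>G\<^esub> x) ` X)"
    using w(1) by auto
  also have "\<dots> = h ` X \<union> (\<lambda>x. inv\<^bsub>H\<^esub> x) ` h ` X"
    using X by (auto simp: image_Un image_image hom_inv subset_iff intro!: image_cong)
  finally have "palindromic_word H (h ` X) (map h w)"
    using w(2) by (simp add: palindromic_word_def rev_map)
  moreover have "y = list_prod H (map h w)"
    using w G.letters_closed[OF X] hom_list_prod[of w] by auto
  ultimately show "y \<in> palindromic_elements H (h ` X)"
    by (simp add: palindromic_elementsI)
qed

lemma (in group_hom) bounded_palindromic_image:
  assumes X: "X \<subseteq> carrier G" and S: "bounded_palindromic G X S"
  shows "bounded_palindromic H (h ` X) (h ` S)"
proof -
  obtain n where n: "\<And>g. g \<in> S \<Longrightarrow> \<exists>ps. length ps \<le> n \<and>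
      set ps \<subseteq> palindromic_elements G X \<and> g = list_prod G ps"
    using S unfolding bounded_palindromic_def by blast
  have "\<exists>qs. length qs \<le> n \<and> set qs \<subseteq> palindromic_elements H (h ` X) \<and> h g = list_prod H qs"
    if g: "g \<in> S" for g
  proof -
    obtain ps where ps: "length ps \<le> n" "set ps \<subseteq> palindromic_elements G X" "g = list_prod G ps"
      using n[OF g] by blast
    then have "h g = list_prod H (map h ps)"
      using G.palindromic_elements_closed[OF X] hom_list_prod by blast
    moreover have "set (map h ps) \<subseteq> palindromic_elements H (h ` X)"
      using ps(2) palindromic_elements_image[OF X] by auto
    ultimately show ?thesis
      using ps(1) by (metis length_map)
  qed
  then show ?thesis
    unfolding bounded_palindromic_def by blast
qed

lemma (in group_hom) finitely_generated_image:
  assumes "finitely_generated G" "h ` carrier G = carrier H"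
  shows "finitely_generated H"
proof -
  obtain X where X: "finite X" "X \<subseteq> carrier G" "generate G X = carrier G"
    using assms(1) unfolding finitely_generated_def generating_set_def by blast
  then have "generating_set H (h ` X)"
    using generate_img[OF X(2)] assms(2) by (auto simp: generating_set_def)
  with X(1) show ?thesis
    unfolding finitely_generated_def by blast
qed

lemma (in group_hom) boundedly_generated_image:
  assumes G: "boundedly_generated G" and surj: "h ` carrier G = carrier H"
  shows "boundedly_generated H"
proof -
  obtain as where as: "set as \<subseteq> carrier G"
    "\<And>g. g \<in> carrier G \<Longrightarrow> \<exists>rs :: int list. length rs = length as \<and>
        g = list_prod G (map2 (\<lambda>a r. a [^]\<^bsub>G\<^esub> r) as rs)"
    using G unfolding boundedly_generated_def by blast
  \<comment> \<open>Membership in the carrier is proved alongside, since multiplicativity of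
    \<open>h\<close> needs it at each step of the induction.\<close>
  have pow: "h (list_prod G (map2 (\<lambda>a r. a [^]\<^bsub>G\<^esub> r) as rs)) =
      list_prod H (map2 (\<lambda>a r. a [^]\<^bsub>H\<^esub> r) (map h as) rs) \<and>
      list_prod G (map2 (\<lambda>a r. a [^]\<^bsub>G\<^esub> r) as rs) \<in> carrier G"
    if "length rs = length as" for rs :: "int list"
    using that[symmetric] as(1)
    by (induction as rs rule: list_induct2) (auto simp: hom_int_pow)
  show ?thesis
    unfolding boundedly_generated_def
  proof (intro exI[of _ "map h as"] conjI ballI)
    fix y assume "y \<in> carrier H"
    then obtain g where "g \<in> carrier G" "y = h g"
      using surj by blast
    then show "\<exists>rs :: int list. length rs = length (map h as) \<and>
        y = list_prod H (map2 (\<lambda>a r. a [^]\<^bsub>H\<^esub> r) (map h as) rs)"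
      using as(2) pow by (metis length_map)
  qed (use as(1) in auto)
qed

text \<open>A generating set of \<open>H\<close> is pulled back by the inverse isomorphism, and the
  palindromes obtained in \<open>G\<close> are pushed forward by \<open>h\<close>.\<close>

lemma palindromic_width_finite_iso:
  assumes G: "group G" and H: "group H" and iso: "h \<in> iso G H"
    and fin: "\<And>X. finite X \<Longrightarrow> generating_set G X \<Longrightarrow> palindromic_width G X < \<infinity>"
    and Y: "finite Y" "generating_set H Y"
  shows "palindromic_width H Y < \<infinity>"
proof -
  interpret h: group_hom G H h
    using G H iso by (simp add: group_hom_def group_hom_axioms_def iso_def)
  let ?k = "inv_into (carrier G) h"
  have kiso: "?k \<in> iso H G"
    using h.G.iso_set_sym[OF iso] .
  interpret k: group_hom H G ?k
    using G H kiso by (simp add: group_hom_def group_hom_axioms_def iso_def)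
  have surj: "h ` carrier G = carrier H" "?k ` carrier H = carrier G"
    using iso kiso by (auto simp: iso_def bij_betw_def)
  have Y': "Y \<subseteq> carrier H" "generate H Y = carrier H"
    using Y by (auto simp: generating_set_def)
  have gen: "generating_set G (?k ` Y)"
    using k.generate_img[OF Y'(1)] Y' surj by (auto simp: generating_set_def)
  have "h ` ?k ` Y = Y"
    using Y' surj by (intro image_inv_into_cancel) auto
  moreover have "bounded_palindromic G (?k ` Y) (carrier G)"
    using fin[of "?k ` Y"] Y gen unfolding palindromic_width_finite_iff by simp
  ultimately show ?thesis
    using h.bounded_palindromic_image[of "?k ` Y" "carrier G"] gen surj
    unfolding palindromic_width_finite_iff generating_set_def by simp
qed

section \<open>Products of cyclic subgroups and quotients of finite exponent\<close>

text \<open>Here \<open>q\<close> plays the role of the projection to a quotient group of exponent dividing \<open>e\<close>.\<close>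

lemma (in group) card_quotient_le:
  fixes as :: "'a list" and q :: "'a \<Rightarrow> 'q" and e :: nat
  assumes as: "set as \<subseteq> carrier G"
    and gen: "\<And>g. g \<in> carrier G \<Longrightarrow> \<exists>rs :: int list. length rs = length as \<and>
        g = list_prod G (map2 (\<lambda>a r. a [^] r) as rs)"
    and cong: "\<And>x x' y y'. \<lbrakk>x \<in> carrier G; x' \<in> carrier G; y \<in> carrier G; y' \<in> carrier G;
        q x = q x'; q y = q y'\<rbrakk> \<Longrightarrow> q (x \<otimes> y) = q (x' \<otimes> y')"
    and exponent: "\<And>x. x \<in> carrier G \<Longrightarrow> q (x [^] e) = q \<one>"
    and e: "e > 0"
  shows "finite (q ` carrier G) \<and> card (q ` carrier G) \<le> e ^ length as"
proof -
  \<comment> \<open>Division with remainder splits off from \<open>a [^] r\<close> an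
    \<open>e\<close>-th power, which \<open>q\<close> identifies with \<open>\<one>\<close>.\<close>
  have pow: "q (a [^] r) = q (a [^] (r mod int e))" if a: "a \<in> carrier G" for a and r :: int
  proof -
    have "a [^] r = a [^] (r mod int e + (r div int e) * int e)"
      by simp
    also have "\<dots> = a [^] (r mod int e) \<otimes> a [^] ((r div int e) * int e)"
      using a by (rule int_pow_mult)
    also have "a [^] ((r div int e) * int e) = (a [^] (r div int e)) [^] e"
      using a by (simp add: int_pow_pow flip: int_pow_int)
    finally have "q (a [^] r) = q (a [^] (r mod int e) \<otimes> (a [^] (r div int e)) [^] e)"
      by (rule arg_cong)
    also have "\<dots> = q (a [^] (r mod int e) \<otimes> \<one>)"
      using a exponent by (intro cong) auto
    finally show ?thesis using a by simp
  qed
  have prod: "list_prod G (map2 (\<lambda>a r. a [^] r) as rs) \<in> carrier G \<and>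
      list_prod G (map2 (\<lambda>a r. a [^] r) as (map (\<lambda>r. r mod int e) rs)) \<in> carrier G \<and>
      q (list_prod G (map2 (\<lambda>a r. a [^] r) as rs)) =
      q (list_prod G (map2 (\<lambda>a r. a [^] r) as (map (\<lambda>r. r mod int e) rs)))"
    if "length rs = length as" for rs :: "int list"
    using that[symmetric] as
  proof (induction as rs rule: list_induct2)
    case (Cons a as r rs)
    let ?p = "list_prod G (map2 (\<lambda>a r. a [^] r) as rs)"
    let ?p' = "list_prod G (map2 (\<lambda>a r. a [^] r) as (map (\<lambda>r. r mod int e) rs))"
    have a: "a \<in> carrier G" and IH: "?p \<in> carrier G" "?p' \<in> carrier G" "q ?p = q ?p'"
      using Cons by auto
    have "q (a [^] r \<otimes> ?p) = q (a [^] (r mod int e) \<otimes> ?p')"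
      using a IH by (intro cong pow) auto
    with a IH show ?case by simp
  qed simp
  \<comment> \<open>The exponent vectors reduced modulo \<open>e\<close>: they already produce every
    value of \<open>q\<close>, and there are \<open>e ^ length as\<close> of them.\<close>
  let ?R = "{rs. set rs \<subseteq> {0..<int e} \<and> length rs = length as}"
  have fin: "finite ?R"
    by (intro finite_lists_length_eq) simp
  have sub: "q ` carrier G \<subseteq> (\<lambda>rs. q (list_prod G (map2 (\<lambda>a r. a [^] r) as rs))) ` ?R"
  proof
    fix y assume "y \<in> q ` carrier G"
    then obtain g where g: "g \<in> carrier G" "y = q g"
      by blast
    then obtain rs :: "int list" where rs: "length rs = length as"
        "y = q (list_prod G (map2 (\<lambda>a r. a [^] r) as rs))"
      using gen by blast
    then show "y \<in> (\<lambda>rs. q (list_prod G (map2 (\<lambda>a r. a [^] r) as rs))) ` ?R"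
      using prod[OF rs(1)] e by (intro image_eqI[of _ _ "map (\<lambda>r. r mod int e) rs"]) auto
  qed
  have "finite (q ` carrier G)"
    using sub fin by (rule finite_surj[rotated])
  moreover have "card (q ` carrier G) \<le> card ?R"
    using sub fin by (rule surj_card_le[rotated])
  moreover have "card ?R = e ^ length as"
    by (simp add: card_lists_length_eq)
  ultimately show ?thesis by simp
qed

section \<open>The lamplighter group\<close>

text \<open>\<open>(S, m)\<close> has its lamps lit at the positions in \<open>S\<close> and its lamplighter at \<open>m\<close>;
  the disequality of truth values is exclusive or.\<close>

definition lamplighter :: "(int set \<times> int) monoid"
  where "lamplighter =
    \<lparr>carrier = {(S, m). finite S},
     mult = (\<lambda>(S, m) (T, k). ({i. (i \<in> S) \<noteq> (i - m \<in> T)}, m + k)),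
     one = ({}, 0)\<rparr>"

lemma lamplighter_carrier [simp]: "(S, m) \<in> carrier lamplighter \<longleftrightarrow> finite S"
  by (simp add: lamplighter_def)

lemma lamplighter_mult [simp]:
  "(S, m) \<otimes>\<^bsub>lamplighter\<^esub> (T, k) = ({i. (i \<in> S) \<noteq> (i - m \<in> T)}, m + k)"
  by (simp add: lamplighter_def)

lemma lamplighter_one [simp]: "\<one>\<^bsub>lamplighter\<^esub> = ({}, 0)"
  by (simp add: lamplighter_def)

lemma finite_shift: "finite T \<Longrightarrow> finite {i::int. i - m \<in> T}"
  using finite_vimageI[of T "\<lambda>i. i - m"] by (simp add: vimage_def inj_on_def)

text \<open>The exclusive or appears here in the form into which simplification rewrites a
  disequality of truth values.\<close>

lemma finite_xor: "finite S \<Longrightarrow> finite {i. P i} \<Longrightarrow> finite {i. (i \<in> S) = (\<not> P i)}"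
  by (rule finite_subset[of _ "S \<union> {i. P i}"]) auto

lemma lamplighter_inverse:
  assumes "finite S"
  shows "finite {i. i + m \<in> S}"
    "({i. i + m \<in> S}, - m) \<otimes>\<^bsub>lamplighter\<^esub> (S, m) = \<one>\<^bsub>lamplighter\<^esub>"
  using finite_shift[of S "- m"] assms by simp_all

lemma group_lamplighter: "group lamplighter"
proof (rule groupI)
  fix x assume "x \<in> carrier lamplighter"
  then show "\<exists>y\<in>carrier lamplighter. y \<otimes>\<^bsub>lamplighter\<^esub> x = \<one>\<^bsub>lamplighter\<^esub>"
    using lamplighter_inverse by (cases x) (metis lamplighter_carrier)
qed (auto simp: finite_xor finite_shift algebra_simps)

interpretation lamplighter: group lamplighter
  by (rule group_lamplighter)

lemma lamplighter_inv [simp]: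
  "finite S \<Longrightarrow> inv\<^bsub>lamplighter\<^esub> (S, m) = ({i. i + m \<in> S}, - m)"
  using lamplighter_inverse[of S m] by (intro lamplighter.inv_equality) simp_all

text \<open>The generators are the lamp at \<open>0\<close> and the unit step. Conjugating the lamp
  by steps gives every single lamp, and products of these give every finite configuration.\<close>

lemma finitely_generated_lamplighter: "finitely_generated lamplighter"
proof -
  let ?X = "{({0}, 0), ({}, 1)} :: (int set \<times> int) set"
  let ?H = "generate lamplighter ?X"
  have X: "?X \<subseteq> carrier lamplighter"
    by simp
  have shift: "({}, m) \<in> ?H" for m
  proof (induction m rule: int_induct[of _ 0])
    case base
    show ?case using generate.one[of lamplighter ?X] by simp
  next
    case (step1 i)
    then show ?case
      using generate.eng[OF step1(2) generate.incl[of "({}, 1)" ?X lamplighter]] by simp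
  next
    case (step2 i)
    then show ?case
      using generate.eng[OF step2(2) generate.inv[of "({}, 1)" ?X lamplighter]] by simp
  qed
  have single: "({j}, 0) \<in> ?H" for j
  proof -
    have "({}, j) \<otimes>\<^bsub>lamplighter\<^esub> ({0}, 0) \<otimes>\<^bsub>lamplighter\<^esub> ({}, - j) \<in> ?H"
      by (intro generate.eng shift generate.incl) simp
    then show ?thesis by simp
  qed
  have lamps: "(S, 0) \<in> ?H" if "finite S" for S
    using that
  proof induction
    case empty
    show ?case by (rule shift)
  next
    case (insert j S)
    have "({j}, 0) \<otimes>\<^bsub>lamplighter\<^esub> (S, 0) \<in> ?H"
      by (intro generate.eng single insert)
    \<comment> \<open>As \<open>j\<close> is not in \<open>S\<close>, toggling the lamp at
      \<open>j\<close> lights it.\<close>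
    moreover have "{i. (i = j) \<noteq> (i \<in> S)} = insert j S"
      using insert by auto
    ultimately show ?case by simp
  qed
  have "x \<in> ?H" if x: "x \<in> carrier lamplighter" for x
  proof (cases x)
    case (Pair S m)
    then have "(S, 0) \<otimes>\<^bsub>lamplighter\<^esub> ({}, m) \<in> ?H"
      using x by (intro generate.eng lamps shift) simp
    then show ?thesis using Pair by simp
  qed
  moreover have "?H \<subseteq> carrier lamplighter"
    using lamplighter.generate_incl[OF X] .
  ultimately have "generating_set lamplighter ?X"
    using X unfolding generating_set_def by blast
  moreover have "finite ?X"
    by simp
  ultimately show ?thesis
    unfolding finitely_generated_def by blast
qed

text \<open>In terms of Laurent polynomials over the field with two elements:
  \<open>1 + t\<close> divides \<open>(1 + t\<^sup>k) S\<close>.\<close>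

lemma shift_difference:
  fixes S :: "int set" and k :: int
  assumes "finite S"
  shows "\<exists>U. finite U \<and> (\<forall>i. ((i \<in> U) \<noteq> (i - 1 \<in> U)) \<longleftrightarrow> ((i \<in> S) \<noteq> (i - k \<in> S)))"
proof (induction k rule: int_induct[of _ 0])
  case base
  show ?case by (intro exI[of _ "{}"]) simp
next
  case (step1 k)
  then obtain U where U: "finite U" "\<And>i. ((i \<in> U) \<noteq> (i - 1 \<in> U)) \<longleftrightarrow> ((i \<in> S) \<noteq> (i - k \<in> S))"
    by blast
  \<comment> \<open>From \<open>1 + t^(k+1) = (1 + t^k) + t^k (1 + t)\<close>: the new quotient is
    \<open>U + t^k S\<close>.\<close>
  let ?V = "{i. (i \<in> U) \<noteq> (i - k \<in> S)}"
  have eq: "i - 1 - k = i - (k + 1)" for i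
    by simp
  have "((i \<in> ?V) \<noteq> (i - 1 \<in> ?V)) \<longleftrightarrow> ((i \<in> S) \<noteq> (i - (k + 1) \<in> S))" for i
    using U(2)[of i] unfolding mem_Collect_eq eq by blast
  moreover have "finite ?V"
    using U(1) assms by (simp add: finite_xor finite_shift)
  ultimately show ?case by blast
next
  case (step2 k)
  then obtain U where U: "finite U" "\<And>i. ((i \<in> U) \<noteq> (i - 1 \<in> U)) \<longleftrightarrow> ((i \<in> S) \<noteq> (i - k \<in> S))"
    by blast
  \<comment> \<open>From \<open>1 + t^(k-1) = (1 + t^k) + t^(k-1) (1 + t)\<close>: the new quotient
    is \<open>U + t^(k-1) S\<close>.\<close>
  let ?V = "{i. (i \<in> U) \<noteq> (i - (k - 1) \<in> S)}"
  have eq: "i - 1 - (k - 1) = i - k" for i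
    by simp
  have "((i \<in> ?V) \<noteq> (i - 1 \<in> ?V)) \<longleftrightarrow> ((i \<in> S) \<noteq> (i - (k - 1) \<in> S))" for i
    using U(2)[of i] unfolding mem_Collect_eq eq by blast
  moreover have "finite ?V"
    using U(1) assms by (simp add: finite_xor finite_shift)
  ultimately show ?case by blast
qed

text \<open>The general criterion applies with \<open>A\<close> the configurations at position
  \<open>0\<close>: the lamps of any commutator are a multiple of \<open>1 + t\<close>, so it equals
  the commutator of a configuration with the unit step.\<close>

lemma palindromic_width_lamplighter:
  assumes X: "finite X" "generating_set lamplighter X"
  shows "palindromic_width lamplighter X < \<infinity>"
proof (rule lamplighter.palindromic_width_finite[OF _ _ _ X])
  let ?A = "{(S, 0) | S. finite S} :: (int set \<times> int) set"
  have "subgroup ?A lamplighter"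
    by (rule lamplighter.subgroupI) (auto simp: finite_xor)
  then show "?A \<lhd> lamplighter"
    unfolding lamplighter.normal_inv_iff
  proof (intro conjI ballI)
    fix x a assume "x \<in> carrier lamplighter" "a \<in> ?A"
    then obtain S m T where eq: "x = (S, m)" "a = (T, 0)" and fin: "finite S" "finite T"
      by (cases x) auto
    have "x \<otimes>\<^bsub>lamplighter\<^esub> a \<otimes>\<^bsub>lamplighter\<^esub> inv\<^bsub>lamplighter\<^esub> x = ({i. i - m \<in> T}, 0)"
      using fin by (auto simp: eq)
    then show "x \<otimes>\<^bsub>lamplighter\<^esub> a \<otimes>\<^bsub>lamplighter\<^esub> inv\<^bsub>lamplighter\<^esub> x \<in> ?A"
      using fin finite_shift by simp
  qed
  show "a \<otimes>\<^bsub>lamplighter\<^esub> b = b \<otimes>\<^bsub>lamplighter\<^esub> a" if "a \<in> ?A" "b \<in> ?A" for a b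
    using that by auto
  show "\<exists>a\<in>?A. \<exists>g\<in>carrier lamplighter. lamplighter.commutator x y = lamplighter.commutator a g"
    if xy: "x \<in> carrier lamplighter" "y \<in> carrier lamplighter" for x y
  proof -
    obtain S m T k where eq: "x = (S, m)" "y = (T, k)" and fin: "finite S" "finite T"
      using xy by (cases x, cases y) auto
    obtain U where U: "finite U" "\<And>i. ((i \<in> U) \<noteq> (i - 1 \<in> U)) \<longleftrightarrow> ((i \<in> S) \<noteq> (i - k \<in> S))"
      using shift_difference[OF fin(1), of k] by blast
    obtain V where V: "finite V" "\<And>i. ((i \<in> V) \<noteq> (i - 1 \<in> V)) \<longleftrightarrow> ((i \<in> T) \<noteq> (i - m \<in> T))"
      using shift_difference[OF fin(2), of m] by blast
    \<comment> \<open>\<open>W = U + V\<close> satisfies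
      \<open>(1 + t) W = (1 + t^k) S + (1 + t^m) T\<close>, and the right-hand side gives the lamps
      of the commutator of \<open>x\<close> and \<open>y\<close>.\<close>
    let ?W = "{i. (i \<in> U) \<noteq> (i \<in> V)}"
    have W: "finite ?W"
      using U(1) V(1) by (simp add: finite_xor)
    have "lamplighter.commutator x y =
        ({i. ((i \<in> S) \<noteq> (i - k \<in> S)) \<noteq> ((i \<in> T) \<noteq> (i - m \<in> T))}, 0)"
      using fin by (auto simp: eq)
    also have "\<dots> = ({i. (i \<in> ?W) \<noteq> (i - 1 \<in> ?W)}, 0)"
      unfolding U(2)[symmetric] V(2)[symmetric] by auto
    also have "\<dots> = lamplighter.commutator (?W, 0) ({}, 1)"
      using W by simp
    finally show ?thesis
      using W by (intro bexI[of _ "(?W, 0)"] bexI[of _ "({}, 1)"]) simp_all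
  qed
qed

section \<open>Finite quotients of the lamplighter group\<close>

text \<open>Folding the lamps modulo \<open>n\<close> gives the projection to the wreath product of cyclic groups of
  orders \<open>2\<close> and \<open>n\<close>, with lamp configurations encoded as \<open>n\<close>-periodic sets of integers.\<close>

definition fold_lamps :: "nat \<Rightarrow> int set \<Rightarrow> int set"
  where "fold_lamps n S = {i. odd (card {s \<in> S. int n dvd s - i})}"

definition fold_lamplighter :: "nat \<Rightarrow> int set \<times> int \<Rightarrow> int set \<times> int"
  where "fold_lamplighter n = (\<lambda>(S, m). (fold_lamps n S, m mod int n))"

text \<open>Adding the two cardinalities counts the intersection twice, which does not affect
  parity.\<close>

lemma odd_card_xor:
  assumes "finite A" "finite B"
  shows "odd (card {i. (i \<in> A) \<noteq> (i \<in> B)}) \<longleftrightarrow> odd (card A) \<noteq> odd (card B)"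
proof -
  have "{i. (i \<in> A) \<noteq> (i \<in> B)} = (A - B) \<union> (B - A)"
    by auto
  then have "card {i. (i \<in> A) \<noteq> (i \<in> B)} = card (A - B) + card (B - A)"
    using assms by (simp add: card_Un_disjoint disjoint_iff)
  moreover have "card A = card (A - B) + card (A \<inter> B)" "card B = card (B - A) + card (A \<inter> B)"
    using assms card_Diff_subset_Int[of A B] card_Diff_subset_Int[of B A]
      card_mono[of A "A \<inter> B"] card_mono[of B "A \<inter> B"] by (simp_all add: Int_commute)
  ultimately show ?thesis by auto
qed

text \<open>Folding is additive over the field with two elements and commutes with shifts.\<close>

lemma fold_lamps_mult:
  assumes "finite S" "finite T"
  shows "i \<in> fold_lamps n {j. (j \<in> S) = (j - m \<notin> T)} \<longleftrightarrow>
    (i \<in> fold_lamps n S) \<noteq> (i - m \<in> fold_lamps n T)"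
proof -
  let ?A = "{s \<in> S. int n dvd s - i}" and ?B = "{s. s - m \<in> T \<and> int n dvd s - i}"
  have "?B = (\<lambda>s. s + m) ` {s \<in> T. int n dvd s - (i - m)}"
    by (force simp: algebra_simps)
  then have "card ?B = card {s \<in> T. int n dvd s - (i - m)}"
    by (simp add: card_image)
  moreover have "{s \<in> {j. (j \<in> S) = (j - m \<notin> T)}. int n dvd s - i} = {s. (s \<in> ?A) \<noteq> (s \<in> ?B)}"
    by auto
  moreover have "finite ?A" "finite ?B"
    using assms finite_shift[of T m] by auto
  ultimately show ?thesis
    using odd_card_xor[of ?A ?B] by (simp add: fold_lamps_def)
qed

lemma fold_lamps_periodic:
  assumes "i mod int n = j mod int n"
  shows "i \<in> fold_lamps n S \<longleftrightarrow> j \<in> fold_lamps n S"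
proof -
  have "int n dvd s - i \<longleftrightarrow> int n dvd s - j" for s
    using assms by (metis mod_eq_dvd_iff)
  then show ?thesis
    by (simp add: fold_lamps_def)
qed

text \<open>This is compatibility of the fibres with multiplication; it lets
  \<open>card_quotient_le\<close> be applied without constructing the quotient group.\<close>

lemma fold_lamplighter_cong:
  assumes "x \<in> carrier lamplighter" "x' \<in> carrier lamplighter"
    "y \<in> carrier lamplighter" "y' \<in> carrier lamplighter"
    and eq: "fold_lamplighter n x = fold_lamplighter n x'"
      "fold_lamplighter n y = fold_lamplighter n y'"
  shows "fold_lamplighter n (x \<otimes>\<^bsub>lamplighter\<^esub> y) = fold_lamplighter n (x' \<otimes>\<^bsub>lamplighter\<^esub> y')"
proof -
  obtain S m S' m' T k T' k' where xy: "x = (S, m)" "x' = (S', m')" "y = (T, k)" "y' = (T', k')"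
    and fin: "finite S" "finite S'" "finite T" "finite T'"
    using assms(1-4) by (cases x, cases x', cases y, cases y') auto
  have S: "fold_lamps n S = fold_lamps n S'" "fold_lamps n T = fold_lamps n T'"
    and m: "m mod int n = m' mod int n" and k: "k mod int n = k' mod int n"
    using eq by (auto simp: xy fold_lamplighter_def)
  have "(i - m) mod int n = (i - m') mod int n" for i
    using m by (metis mod_diff_right_eq)
  then have "i - m \<in> fold_lamps n T' \<longleftrightarrow> i - m' \<in> fold_lamps n T'" for i
    by (rule fold_lamps_periodic)
  moreover have "(m + k) mod int n = (m' + k') mod int n"
    using m k by (metis mod_add_eq)
  ultimately show ?thesis
    using fin S by (auto simp: xy fold_lamplighter_def fold_lamps_mult)
qed

text \<open>The \<open>n\<close>-th power brings the lamplighter back to \<open>0\<close> modulo \<open>n\<close>, and squaring then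
  extinguishes all lamps.\<close>

lemma fold_lamplighter_pow:
  assumes "x \<in> carrier lamplighter"
  shows "fold_lamplighter n (x [^]\<^bsub>lamplighter\<^esub> (2 * n)) = fold_lamplighter n \<one>\<^bsub>lamplighter\<^esub>"
proof -
  obtain S m where x: "x = (S, m)" "finite S"
    using assms by (cases x) auto
  \<comment> \<open>Only the position is tracked; the lamps of the power remain an unspecified
    finite set.\<close>
  have "\<exists>T. finite T \<and> x [^]\<^bsub>lamplighter\<^esub> l = (T, int l * m)" for l :: nat
  proof (induction l)
    case (Suc l)
    then obtain T where "finite T" "x [^]\<^bsub>lamplighter\<^esub> l = (T, int l * m)"
      by blast
    then show ?case
      using x by (auto simp: finite_xor finite_shift algebra_simps)
  qed simp
  then obtain T where T: "finite T" "x [^]\<^bsub>lamplighter\<^esub> n = (T, int n * m)"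
    by blast
  have "x [^]\<^bsub>lamplighter\<^esub> (2 * n) = x [^]\<^bsub>lamplighter\<^esub> n \<otimes>\<^bsub>lamplighter\<^esub> x [^]\<^bsub>lamplighter\<^esub> n"
    using assms by (simp add: lamplighter.nat_pow_mult mult_2)
  \<comment> \<open>The second factor is shifted by a multiple of \<open>n\<close>, invisible after
    folding, so its lamps cancel those of the first.\<close>
  moreover have "i - int n * m \<in> fold_lamps n T \<longleftrightarrow> i \<in> fold_lamps n T" for i
    by (rule fold_lamps_periodic) (simp add: mod_eq_dvd_iff)
  ultimately show ?thesis
    using T by (auto simp: fold_lamplighter_def fold_lamps_mult) (simp add: fold_lamps_def)
qed

text \<open>Distinct positions in the window \<open>{0..<int n}\<close> are incongruent modulo
  \<open>n\<close>, so intersecting the folded set with the window recovers the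
  configuration.\<close>

lemma fold_lamps_inj: "inj_on (fold_lamps n) (Pow {0..<int n})"
proof (rule inj_onI)
  have fold: "fold_lamps n S \<inter> {0..<int n} = S" if S: "S \<subseteq> {0..<int n}" for S
  proof -
    have "i \<in> fold_lamps n S \<longleftrightarrow> i \<in> S" if i: "i \<in> {0..<int n}" for i
    proof -
      have "s = i" if "s \<in> S" "int n dvd s - i" for s
        using that i S by (metis atLeastLessThan_iff mod_eq_dvd_iff mod_pos_pos_trivial subsetD)
      then have "{s \<in> S. int n dvd s - i} = (if i \<in> S then {i} else {})"
        by auto
      then show ?thesis
        by (simp add: fold_lamps_def)
    qed
    then show ?thesis using S by blast
  qed
  show "S = T" if "S \<in> Pow {0..<int n}" "T \<in> Pow {0..<int n}" "fold_lamps n S = fold_lamps n T"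
    for S T
    using that fold by (metis PowD)
qed

lemma quadratic_le_four_power: "(2 * k + 3) * (k + 1) \<le> (4::nat) ^ (k + 1)"
proof (induction k)
  case (Suc k)
  have "(2 * Suc k + 3) * (Suc k + 1) \<le> 4 * ((2 * k + 3) * (k + 1))"
    by (simp add: algebra_simps)
  also have "\<dots> \<le> 4 * 4 ^ (k + 1)"
    using Suc by (intro mult_left_mono) auto
  finally show ?case by simp
qed simp

lemma not_boundedly_generated_lamplighter: "\<not> boundedly_generated lamplighter"
proof
  assume "boundedly_generated lamplighter"
  then obtain as where as: "set as \<subseteq> carrier lamplighter"
    "\<And>g. g \<in> carrier lamplighter \<Longrightarrow> \<exists>rs :: int list. length rs = length as \<and>
        g = list_prod lamplighter (map2 (\<lambda>a r. a [^]\<^bsub>lamplighter\<^esub> r) as rs)"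
    unfolding boundedly_generated_def by blast
  define k where "k = length as"
  \<comment> \<open>A power of two, so that \<open>(2 * n) ^ k\<close> is one as well and the
    comparison with \<open>2 ^ n\<close> becomes one of exponents; it is chosen large enough that
    \<open>n\<close> exceeds \<open>(2 * k + 3) * k\<close>.\<close>
  define n :: nat where "n = 2 ^ (2 * k + 2)"
  have n: "n > 0"
    by (simp add: n_def)
  have le: "finite (fold_lamplighter n ` carrier lamplighter) \<and>
    card (fold_lamplighter n ` carrier lamplighter) \<le> (2 * n) ^ k"
    unfolding k_def
  proof (rule lamplighter.card_quotient_le)
    show "set as \<subseteq> carrier lamplighter"
      by (rule as(1))
    show "\<exists>rs :: int list. length rs = length as \<and>
        g = list_prod lamplighter (map2 (\<lambda>a r. a [^]\<^bsub>lamplighter\<^esub> r) as rs)"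
      if "g \<in> carrier lamplighter" for g
      using that by (rule as(2))
    show "0 < 2 * n"
      using n by simp
  qed (rule fold_lamplighter_cong fold_lamplighter_pow; assumption)+
  \<comment> \<open>The configurations supported in one period, with the lamplighter at
    \<open>0\<close>, already give \<open>2 ^ n\<close> different images.\<close>
  let ?C = "(\<lambda>S. fold_lamplighter n (S, 0)) ` Pow {0..<int n}"
  have "card ?C = card (Pow {0..<int n})"
    using fold_lamps_inj[of n] by (intro card_image) (auto simp: inj_on_def fold_lamplighter_def)
  then have card: "card ?C = 2 ^ n"
    by (simp add: card_Pow)
  have "?C \<subseteq> fold_lamplighter n ` carrier lamplighter"
    using finite_subset[of _ "{0..<int n}"] by auto
  then have "card ?C \<le> card (fold_lamplighter n ` carrier lamplighter)"
    using le by (intro card_mono) simp_all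
  then have "2 ^ n \<le> (2 * n) ^ k"
    unfolding card using le by linarith
  moreover have "2 * n = 2 ^ (2 * k + 3)"
    by (simp add: n_def numeral_3_eq_3)
  ultimately have "(2::nat) ^ n \<le> 2 ^ ((2 * k + 3) * k)"
    by (simp only: power_mult)
  then have "n \<le> (2 * k + 3) * k"
    by (rule power_le_imp_le_exp[rotated]) simp
  moreover have "(2 * k + 3) * (k + 1) \<le> n"
  proof -
    have "n = (2\<^sup>2) ^ (k + 1)"
      unfolding n_def power_mult[symmetric] by simp
    then show ?thesis
      using quadratic_le_four_power[of k] by simp
  qed
  ultimately show False
    by (simp add: algebra_simps)
qed

section \<open>Transfer to a group on the natural numbers\<close>

theorem corollary1p4:
  shows "\<exists>G :: nat monoid. group G \<and> finitely_generated G \<and>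
    (\<forall>X. finite X \<and> generating_set G X \<longrightarrow> palindromic_width G X < \<infinity>) \<and>
    \<not> boundedly_generated G"
proof -
  have "carrier lamplighter = Collect finite \<times> UNIV"
    by auto
  then have "countable (carrier lamplighter)"
    by (simp add: countable_Collect_finite)
  then obtain f :: "int set \<times> int \<Rightarrow> nat" where f: "inj_on f (carrier lamplighter)"
    unfolding countable_def by blast
  define G where "G = image_group f lamplighter"
  \<comment> \<open>For the trivial normal subgroup, this property amounts to injectivity of
    \<open>f\<close> on the carrier.\<close>
  have "weak_group_morphism f {\<one>\<^bsub>lamplighter\<^esub>} lamplighter"
  proof (rule weak_group_morphismsI[OF lamplighter.one_is_normal])
    fix a b assume ab: "a \<in> carrier lamplighter" "b \<in> carrier lamplighter"
    then have "f a = f b \<longleftrightarrow> a = b"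
      using f by (auto dest: inj_onD)
    also have "\<dots> \<longleftrightarrow> a \<otimes>\<^bsub>lamplighter\<^esub> inv\<^bsub>lamplighter\<^esub> b = \<one>\<^bsub>lamplighter\<^esub>"
      using ab by (metis lamplighter.inv_closed lamplighter.inv_equality lamplighter.inv_inv
          lamplighter.r_inv)
    finally show "f a = f b \<longleftrightarrow> a \<otimes>\<^bsub>lamplighter\<^esub> inv\<^bsub>lamplighter\<^esub> b \<in> {\<one>\<^bsub>lamplighter\<^esub>}"
      by simp
  qed
  then have hom: "group_hom lamplighter G f"
    unfolding G_def by (rule lamplighter.weak_group_morphism_group_hom)
  interpret f: group_hom lamplighter G f
    by (rule hom)
  have surj: "f ` carrier lamplighter = carrier G"
    by (simp add: G_def image_group_carrier)
  have iso: "f \<in> iso lamplighter G"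
    using f surj by (simp add: iso_def bij_betw_def f.homh)
  \<comment> \<open>Bounded generation passes to images, so the lamplighter group has to be
    exhibited as an image of \<open>G\<close>.\<close>
  let ?g = "inv_into (carrier lamplighter) f"
  have "?g \<in> iso G lamplighter"
    using lamplighter.iso_set_sym[OF iso] .
  then have "group_hom G lamplighter ?g" "?g ` carrier G = carrier lamplighter"
    by (auto simp: group_hom_def group_hom_axioms_def iso_def bij_betw_def
        group_lamplighter f.H.group_axioms)
  then have "\<not> boundedly_generated G"
    using group_hom.boundedly_generated_image not_boundedly_generated_lamplighter by blast
  moreover have "finitely_generated G"
    using f.finitely_generated_image[OF finitely_generated_lamplighter surj] .
  moreover have "palindromic_width G X < \<infinity>" if "finite X" "generating_set G X" for X
    using palindromic_width_finite_iso[OF group_lamplighter f.H.group_axioms iso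
        palindromic_width_lamplighter that] .
  ultimately show ?thesis
    using f.H.group_axioms by blast
qed

end
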